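(* For all sets of formulas $\Gamma \subseteq Fm$ and all formulas $\varphi \in Fm$: $\Gamma \models_{\mathcal{LB}} \varphi$ if and only if $\Gamma \vdash_{H} \varphi$.
   Context: $\mathbf{Fm}$ is the algebra of formulas (with universe $Fm$) over a countable set of variables in the language $\{\land,\lor,\otimes,\oplus,\neg\}$ ($\land,\lor,\otimes,\oplus$ binary, $\neg$ unary, no constants). $\mathcal{FOUR}$ is the algebra with universe $\{\mathsf f,\bot,\top,\mathsf t\}$ where $\land,\lor$ are meet and join of the lattice order $\leq_t$ with $\mathsf f <_t \bot,\top <_t \mathsf t$ ($\bot,\top$ $\leq_t$-incomparable), $\otimes,\oplus$ are meet and join of the lattice order $\leq_k$ with $\bot <_k \mathsf f,\mathsf t <_k \top$ ($\mathsf f,\mathsf t$ $\leq_k$-incomparable), and $\neg \mathsf f = \mathsf t$, $\neg\mathsf t=\mathsf f$, $\neg\bot=\bot$, $\neg\top=\top$. Let $\mathsf{Tr}=\{\top,\mathsf t\}$. Define $\Gamma\models_{\mathcal{LB}}\varphi$ iff for every homomorphism $h:\mathbf{Fm}\to\mathcal{FOUR}$, $h[\Gamma]\subseteq \mathsf{Tr}$ implies $h(\varphi)\in\mathsf{Tr}$. $\vdash_H$ is the (finitary, substitution-invariant) consequence relation given by the Hilbert calculus with no axioms and the following rules (premises $/$ conclusion): (R1) $p\land q / p$; (R2) $p\land q/q$; (R3) $p, q/ p\land q$; (R4) $p/p\lor q$; (R5) $p\lor q/q\lor p$; (R6) $p\lor p/p$; (R7) $p\lor(q\lor r)/(p\lor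 q)\lor r$; (R8) $p\lor(q\land r)/(p\lor q)\land(p\lor r)$; (R9) $(p\lor q)\land(p\lor r)/p\lor(q\land r)$; (R10) $p\lor r/\neg\neg p\lor r$; (R11) $\neg\neg p\lor r/p\lor r$; (R12) $\neg(p\lor q)\lor r/(\neg p\land\neg q)\lor r$; (R13) $(\neg p\land\neg q)\lor r/\neg(p\lor q)\lor r$; (R14) $\neg(p\land q)\lor r/(\neg p\lor\neg q)\lor r$; (R15) $(\neg p\lor\neg q)\lor r/\neg(p\land q)\lor r$; (R16) $(p\otimes q)\lor r/(p\land q)\lor r$; (R17) $(p\land q)\lor r/(p\otimes q)\lor r$; (R18) $(p\oplus q)\lor r/(p\lor q)\lor r$; (R19) $(p\lor q)\lor r/(p\oplus q)\lor r$; (R20) $(\neg p\otimes\neg q)\lor r/\neg(p\otimes q)\lor r$; (R21) $\neg(p\otimes q)\lor r/(\neg p\otimes\neg q)\lor r$; (R22) $(\neg p\oplus\neg q)\lor r/\neg(p\oplus q)\lor r$; (R23) $\neg(p\oplus q)\lor r/(\neg p\oplus\neg q)\lor r$. *)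

theory Defs
  imports "HOL-Library.Countable"
begin

datatype (vars: 'v) fm =
    Var 'v
  | Conj "'v fm" "'v fm"   (infixr "\<^bold>\<and>" 70)
  | Disj "'v fm" "'v fm"   (infixr "\<^bold>\<or>" 65)
  | Otimes "'v fm" "'v fm" (infixr "\<otimes>" 70)
  | Oplus "'v fm" "'v fm"  (infixr "\<oplus>" 65)
  | Neg "'v fm"            ("\<^bold>\<not> _" [80] 80)

datatype four = F4 | Bot4 | Top4 | T4

definition le_t :: "four \<Rightarrow> four \<Rightarrow> bool" where
  "le_t x y \<longleftrightarrow> x = y \<or> x = F4 \<or> y = T4"

definition le_k :: "four \<Rightarrow> four \<Rightarrow> bool" where
  "le_k x y \<longleftrightarrow> x = y \<or> x = Bot4 \<or> y = Top4"

definition meet_of :: "(four \<Rightarrow> four \<Rightarrow> bool) \<Rightarrow> four \<Rightarrow> four \<Rightarrow> four" where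
  "meet_of le x y = (THE z. le z x \<and> le z y \<and> (\<forall>w. le w x \<and> le w y \<longrightarrow> le w z))"

definition join_of :: "(four \<Rightarrow> four \<Rightarrow> bool) \<Rightarrow> four \<Rightarrow> four \<Rightarrow> four" where
  "join_of le x y = (THE z. le x z \<and> le y z \<and> (\<forall>w. le x w \<and> le y w \<longrightarrow> le z w))"

fun neg4 :: "four \<Rightarrow> four" where
  "neg4 F4 = T4"
| "neg4 T4 = F4"
| "neg4 Bot4 = Bot4"
| "neg4 Top4 = Top4"

text \<open>The descriptions above are proper: both orders are lattice orders, with these operations.\<close>

lemma four_all: "(\<forall>x. P x) \<longleftrightarrow> P F4 \<and> P Bot4 \<and> P Top4 \<and> P T4"
  by (metis four.exhaust)

lemma meet_t_eq:
  "meet_of le_t x y =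
    (if le_t x y then x else if le_t y x then y else F4)"
  unfolding meet_of_def four_all
  by (rule the_equality; cases x; cases y; auto simp: le_t_def)

lemma join_t_eq:
  "join_of le_t x y =
    (if le_t x y then y else if le_t y x then x else T4)"
  unfolding join_of_def four_all
  by (rule the_equality; cases x; cases y; auto simp: le_t_def)

lemma meet_k_eq:
  "meet_of le_k x y =
    (if le_k x y then x else if le_k y x then y else Bot4)"
  unfolding meet_of_def four_all
  by (rule the_equality; cases x; cases y; auto simp: le_k_def)

lemma join_k_eq:
  "join_of le_k x y =
    (if le_k x y then y else if le_k y x then x else Top4)"
  unfolding join_of_def four_all
  by (rule the_equality; cases x; cases y; auto simp: le_k_def)

lemma lattice_t:
  "class.lattice (meet_of le_t) le_t (\<lambda>x y. le_t x y \<and> x \<noteq> y) (join_of le_t)"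
  by unfold_locales
    (auto simp: le_t_def meet_t_eq join_t_eq split: if_splits)

lemma lattice_k:
  "class.lattice (meet_of le_k) le_k (\<lambda>x y. le_k x y \<and> x \<noteq> y) (join_of le_k)"
  by unfold_locales
    (auto simp: le_k_def meet_k_eq join_k_eq split: if_splits)

definition Tr :: "four set" where
  "Tr = {Top4, T4}"

definition hom_FOUR :: "('v fm \<Rightarrow> four) \<Rightarrow> bool" where
  "hom_FOUR h \<longleftrightarrow>
    (\<forall>p q. h (p \<^bold>\<and> q) = meet_of le_t (h p) (h q)) \<and>
    (\<forall>p q. h (p \<^bold>\<or> q) = join_of le_t (h p) (h q)) \<and>
    (\<forall>p q. h (p \<otimes> q) = meet_of le_k (h p) (h q)) \<and>
    (\<forall>p q. h (p \<oplus> q) = join_of le_k (h p) (h q)) \<and>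
    (\<forall>p. h (\<^bold>\<not> p) = neg4 (h p))"

definition LB_entails :: "'v fm set \<Rightarrow> 'v fm \<Rightarrow> bool" (infix "\<Turnstile>\<^sub>L\<^sub>B" 50) where
  "\<Gamma> \<Turnstile>\<^sub>L\<^sub>B \<phi> \<longleftrightarrow> (\<forall>h. hom_FOUR h \<longrightarrow> h ` \<Gamma> \<subseteq> Tr \<longrightarrow> h \<phi> \<in> Tr)"

text \<open>The rules are schematic in \<open>p\<close>, \<open>q\<close>, \<open>r\<close>, which range over all formulas; this builds
  substitution invariance into the calculus.\<close>

inductive H_derives :: "'v fm set \<Rightarrow> 'v fm \<Rightarrow> bool" (infix "\<turnstile>\<^sub>H" 50)
  for \<Gamma> :: "'v fm set" where
  Hyp: "\<phi> \<in> \<Gamma> \<Longrightarrow> \<Gamma> \<turnstile>\<^sub>H \<phi>"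
| R1: "\<Gamma> \<turnstile>\<^sub>H p \<^bold>\<and> q \<Longrightarrow> \<Gamma> \<turnstile>\<^sub>H p"
| R2: "\<Gamma> \<turnstile>\<^sub>H p \<^bold>\<and> q \<Longrightarrow> \<Gamma> \<turnstile>\<^sub>H q"
| R3: "\<Gamma> \<turnstile>\<^sub>H p \<Longrightarrow> \<Gamma> \<turnstile>\<^sub>H q \<Longrightarrow> \<Gamma> \<turnstile>\<^sub>H p \<^bold>\<and> q"
| R4: "\<Gamma> \<turnstile>\<^sub>H p \<Longrightarrow> \<Gamma> \<turnstile>\<^sub>H p \<^bold>\<or> q"
| R5: "\<Gamma> \<turnstile>\<^sub>H p \<^bold>\<or> q \<Longrightarrow> \<Gamma> \<turnstile>\<^sub>H q \<^bold>\<or> p"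
| R6: "\<Gamma> \<turnstile>\<^sub>H p \<^bold>\<or> p \<Longrightarrow> \<Gamma> \<turnstile>\<^sub>H p"
| R7: "\<Gamma> \<turnstile>\<^sub>H p \<^bold>\<or> (q \<^bold>\<or> r) \<Longrightarrow> \<Gamma> \<turnstile>\<^sub>H (p \<^bold>\<or> q) \<^bold>\<or> r"
| R8: "\<Gamma> \<turnstile>\<^sub>H p \<^bold>\<or> (q \<^bold>\<and> r) \<Longrightarrow> \<Gamma> \<turnstile>\<^sub>H (p \<^bold>\<or> q) \<^bold>\<and> (p \<^bold>\<or> r)"
| R9: "\<Gamma> \<turnstile>\<^sub>H (p \<^bold>\<or> q) \<^bold>\<and> (p \<^bold>\<or> r) \<Longrightarrow> \<Gamma> \<turnstile>\<^sub>H p \<^bold>\<or> (q \<^bold>\<and> r)"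
| R10: "\<Gamma> \<turnstile>\<^sub>H p \<^bold>\<or> r \<Longrightarrow> \<Gamma> \<turnstile>\<^sub>H (\<^bold>\<not> (\<^bold>\<not> p)) \<^bold>\<or> r"
| R11: "\<Gamma> \<turnstile>\<^sub>H (\<^bold>\<not> (\<^bold>\<not> p)) \<^bold>\<or> r \<Longrightarrow> \<Gamma> \<turnstile>\<^sub>H p \<^bold>\<or> r"
| R12: "\<Gamma> \<turnstile>\<^sub>H (\<^bold>\<not> (p \<^bold>\<or> q)) \<^bold>\<or> r \<Longrightarrow> \<Gamma> \<turnstile>\<^sub>H ((\<^bold>\<not> p) \<^bold>\<and> (\<^bold>\<not> q)) \<^bold>\<or> r"
| R13: "\<Gamma> \<turnstile>\<^sub>H ((\<^bold>\<not> p) \<^bold>\<and> (\<^bold>\<not> q)) \<^bold>\<or> r \<Longrightarrow> \<Gamma> \<turnstile>\<^sub>H (\<^bold>\<not> (p \<^bold>\<or> q)) \<^bold>\<or> r"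
| R14: "\<Gamma> \<turnstile>\<^sub>H (\<^bold>\<not> (p \<^bold>\<and> q)) \<^bold>\<or> r \<Longrightarrow> \<Gamma> \<turnstile>\<^sub>H ((\<^bold>\<not> p) \<^bold>\<or> (\<^bold>\<not> q)) \<^bold>\<or> r"
| R15: "\<Gamma> \<turnstile>\<^sub>H ((\<^bold>\<not> p) \<^bold>\<or> (\<^bold>\<not> q)) \<^bold>\<or> r \<Longrightarrow> \<Gamma> \<turnstile>\<^sub>H (\<^bold>\<not> (p \<^bold>\<and> q)) \<^bold>\<or> r"
| R16: "\<Gamma> \<turnstile>\<^sub>H (p \<otimes> q) \<^bold>\<or> r \<Longrightarrow> \<Gamma> \<turnstile>\<^sub>H (p \<^bold>\<and> q) \<^bold>\<or> r"
| R17: "\<Gamma> \<turnstile>\<^sub>H (p \<^bold>\<and> q) \<^bold>\<or> r \<Longrightarrow> \<Gamma> \<turnstile>\<^sub>H (p \<otimes> q) \<^bold>\<or> r"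
| R18: "\<Gamma> \<turnstile>\<^sub>H (p \<oplus> q) \<^bold>\<or> r \<Longrightarrow> \<Gamma> \<turnstile>\<^sub>H (p \<^bold>\<or> q) \<^bold>\<or> r"
| R19: "\<Gamma> \<turnstile>\<^sub>H (p \<^bold>\<or> q) \<^bold>\<or> r \<Longrightarrow> \<Gamma> \<turnstile>\<^sub>H (p \<oplus> q) \<^bold>\<or> r"
| R20: "\<Gamma> \<turnstile>\<^sub>H ((\<^bold>\<not> p) \<otimes> (\<^bold>\<not> q)) \<^bold>\<or> r \<Longrightarrow> \<Gamma> \<turnstile>\<^sub>H (\<^bold>\<not> (p \<otimes> q)) \<^bold>\<or> r"
| R21: "\<Gamma> \<turnstile>\<^sub>H (\<^bold>\<not> (p \<otimes> q)) \<^bold>\<or> r \<Longrightarrow> \<Gamma> \<turnstile>\<^sub>H ((\<^bold>\<not> p) \<otimes> (\<^bold>\<not> q)) \<^bold>\<or> r"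
| R22: "\<Gamma> \<turnstile>\<^sub>H ((\<^bold>\<not> p) \<oplus> (\<^bold>\<not> q)) \<^bold>\<or> r \<Longrightarrow> \<Gamma> \<turnstile>\<^sub>H (\<^bold>\<not> (p \<oplus> q)) \<^bold>\<or> r"
| R23: "\<Gamma> \<turnstile>\<^sub>H (\<^bold>\<not> (p \<oplus> q)) \<^bold>\<or> r \<Longrightarrow> \<Gamma> \<turnstile>\<^sub>H ((\<^bold>\<not> p) \<oplus> (\<^bold>\<not> q)) \<^bold>\<or> r"

end

theory Submission
  imports Defs
begin

text \<open>Every rule of the calculus remains derivable when a common disjunct is added to its premises
  and conclusion. Consequently a theory that is maximal among those not deriving a given formula is
  prime, and recording for each formula \<open>p\<close> whether \<open>p\<close> and \<open>\<^bold>\<not> p\<close> belong to such a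
  theory gives a homomorphism into the four-element algebra. The delicate point is that commutativity
  and associativity of disjunction are given only at the root of a formula; that they may be applied
  below a further disjunct has to be obtained from weakening and contraction.\<close>

lemma H_derives_mono: "\<Gamma> \<turnstile>\<^sub>H \<phi> \<Longrightarrow> \<Gamma> \<subseteq> \<Delta> \<Longrightarrow> \<Delta> \<turnstile>\<^sub>H \<phi>"
  by (induction rule: H_derives.induct) (blast intro: H_derives.intros)+

lemma H_derives_trans: "\<Gamma> \<turnstile>\<^sub>H \<phi> \<Longrightarrow> (\<And>\<gamma>. \<gamma> \<in> \<Gamma> \<Longrightarrow> \<Delta> \<turnstile>\<^sub>H \<gamma>) \<Longrightarrow> \<Delta> \<turnstile>\<^sub>H \<phi>"
  by (induction rule: H_derives.induct) (blast intro: H_derives.intros)+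

text \<open>Finitariness in the form needed for Zorn's lemma. Only \<open>R3\<close> has two
  premises; their witnesses in the chain are comparable, so the larger one derives both.\<close>

lemma H_derives_Union_chain:
  assumes "\<Union>C \<turnstile>\<^sub>H \<phi>" and "subset.chain A C" and "C \<noteq> {}"
  shows "\<exists>T\<in>C. T \<turnstile>\<^sub>H \<phi>"
  using assms(1)
proof (induction rule: H_derives.induct)
  case (R3 p q)
  then obtain S T where ST: "S \<in> C" "S \<turnstile>\<^sub>H p" "T \<in> C" "T \<turnstile>\<^sub>H q" by blast
  moreover have "S \<subseteq> T \<or> T \<subseteq> S"
    using assms(2) ST unfolding subset.chain_def by blast
  ultimately show ?case
    by (blast intro: H_derives.R3 dest: H_derives_mono)
qed (blast intro: H_derives.intros)+

subsection \<open>Rules below a further disjunct\<close>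

text \<open>\<open>R7\<close> reassociates to the left only. The converse arises by rotating the
  three disjuncts cyclically, alternating \<open>R5\<close> and \<open>R7\<close>.\<close>

lemma disj_assoc: "\<Gamma> \<turnstile>\<^sub>H (p \<^bold>\<or> q) \<^bold>\<or> r \<Longrightarrow> \<Gamma> \<turnstile>\<^sub>H p \<^bold>\<or> (q \<^bold>\<or> r)"
  by (intro R5[of \<Gamma> "q \<^bold>\<or> r" p] R7[of \<Gamma> q r p] R5[of \<Gamma> "r \<^bold>\<or> p" q] R7[of \<Gamma> r p q]
      R5[of \<Gamma> "p \<^bold>\<or> q" r])

lemma disj_weaken_left: "\<Gamma> \<turnstile>\<^sub>H p \<Longrightarrow> \<Gamma> \<turnstile>\<^sub>H q \<^bold>\<or> p"
  by (blast intro: R4 R5)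

lemma disj_weaken_lift: "\<Gamma> \<turnstile>\<^sub>H p \<^bold>\<or> r \<Longrightarrow> \<Gamma> \<turnstile>\<^sub>H (p \<^bold>\<or> q) \<^bold>\<or> r"
  by (intro R5[of \<Gamma> r "p \<^bold>\<or> q"] disj_assoc R4[of \<Gamma> "r \<^bold>\<or> p"] R5[of \<Gamma> p r])

lemma disj_comm_lift:
  assumes "\<Gamma> \<turnstile>\<^sub>H (p \<^bold>\<or> q) \<^bold>\<or> r"
  shows "\<Gamma> \<turnstile>\<^sub>H (q \<^bold>\<or> p) \<^bold>\<or> r"
proof -
  let ?Y = "(q \<^bold>\<or> p) \<^bold>\<or> r"
  have "\<Gamma> \<turnstile>\<^sub>H (r \<^bold>\<or> p) \<^bold>\<or> q"
    using assms by (blast intro: R5 R7)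
  \<comment> \<open>The \<open>p\<close> appended by \<open>R4\<close> supplies the pair
    \<open>q\<close>, \<open>p\<close> in the new order, so a first copy of \<open>?Y\<close> can be
    assembled with the old \<open>p\<close> left over.\<close>
  then have "\<Gamma> \<turnstile>\<^sub>H (r \<^bold>\<or> p) \<^bold>\<or> (q \<^bold>\<or> p)"
    by (rule disj_assoc[OF R4])
  then have "\<Gamma> \<turnstile>\<^sub>H ?Y \<^bold>\<or> p"
    by (blast intro: R5 R7[of _ "q \<^bold>\<or> p"])
  \<comment> \<open>A fresh \<open>q\<close> before the leftover \<open>p\<close>, and later a fresh
    \<open>r\<close> behind it, complete a second copy of \<open>?Y\<close> for \<open>R6\<close> to
    absorb.\<close>
  then have "\<Gamma> \<turnstile>\<^sub>H q \<^bold>\<or> (p \<^bold>\<or> ?Y)"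
    by (rule disj_weaken_left[OF R5])
  then have "\<Gamma> \<turnstile>\<^sub>H ?Y \<^bold>\<or> (q \<^bold>\<or> p)"
    by (rule R5[OF R7])
  then have "\<Gamma> \<turnstile>\<^sub>H ?Y \<^bold>\<or> ?Y"
    by (rule disj_assoc[OF R4])
  then show ?thesis by (rule R6)
qed

lemma disj_weaken_left_lift: "\<Gamma> \<turnstile>\<^sub>H p \<^bold>\<or> r \<Longrightarrow> \<Gamma> \<turnstile>\<^sub>H (q \<^bold>\<or> p) \<^bold>\<or> r"
  by (blast intro: disj_comm_lift disj_weaken_lift)

text \<open>A second \<open>r\<close> appended by \<open>R4\<close> gives two copies of
  \<open>p \<or> r\<close>, so contraction at the root suffices.\<close>

lemma disj_contract_lift: "\<Gamma> \<turnstile>\<^sub>H (p \<^bold>\<or> p) \<^bold>\<or> r \<Longrightarrow> \<Gamma> \<turnstile>\<^sub>H p \<^bold>\<or> r"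
  by (intro R6[of \<Gamma> "p \<^bold>\<or> r"] disj_assoc[of \<Gamma> "p \<^bold>\<or> r" p r] R4[of \<Gamma> "(p \<^bold>\<or> r) \<^bold>\<or> p"]
      R5[of \<Gamma> p "p \<^bold>\<or> r"] disj_assoc[of \<Gamma> p p r])

text \<open>Each of the four disjuncts is enlarged to the whole conclusion, and the copies are contracted.\<close>

lemma disj_assoc_lift:
  assumes "\<Gamma> \<turnstile>\<^sub>H (p \<^bold>\<or> (q \<^bold>\<or> r)) \<^bold>\<or> s"
  shows "\<Gamma> \<turnstile>\<^sub>H ((p \<^bold>\<or> q) \<^bold>\<or> r) \<^bold>\<or> s"
proof -
  let ?T = "((p \<^bold>\<or> q) \<^bold>\<or> r) \<^bold>\<or> s"
  have p: "\<Gamma> \<turnstile>\<^sub>H p \<^bold>\<or> x \<Longrightarrow> \<Gamma> \<turnstile>\<^sub>H ?T \<^bold>\<or> x" for x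
    by (intro disj_weaken_lift)
  have q: "\<Gamma> \<turnstile>\<^sub>H q \<^bold>\<or> x \<Longrightarrow> \<Gamma> \<turnstile>\<^sub>H ?T \<^bold>\<or> x" for x
    by (intro disj_weaken_lift[of \<Gamma> "(p \<^bold>\<or> q) \<^bold>\<or> r"] disj_weaken_lift[of \<Gamma> "p \<^bold>\<or> q"]
        disj_weaken_left_lift)
  have r: "\<Gamma> \<turnstile>\<^sub>H r \<^bold>\<or> x \<Longrightarrow> \<Gamma> \<turnstile>\<^sub>H ?T \<^bold>\<or> x" for x
    by (intro disj_weaken_lift[of \<Gamma> "(p \<^bold>\<or> q) \<^bold>\<or> r"] disj_weaken_left_lift)
  have s: "\<Gamma> \<turnstile>\<^sub>H s \<^bold>\<or> x \<Longrightarrow> \<Gamma> \<turnstile>\<^sub>H ?T \<^bold>\<or> x" for x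
    by (rule disj_weaken_left_lift)
  have "\<Gamma> \<turnstile>\<^sub>H ?T \<^bold>\<or> ((q \<^bold>\<or> r) \<^bold>\<or> s)"
    by (rule p[OF disj_assoc[OF assms]])
  then have "\<Gamma> \<turnstile>\<^sub>H ((q \<^bold>\<or> r) \<^bold>\<or> s) \<^bold>\<or> ?T"
    by (rule R5)
  then have "\<Gamma> \<turnstile>\<^sub>H ?T \<^bold>\<or> (r \<^bold>\<or> (s \<^bold>\<or> ?T))"
    by (rule q[OF disj_assoc[OF disj_assoc]])
  then have "\<Gamma> \<turnstile>\<^sub>H (r \<^bold>\<or> (s \<^bold>\<or> ?T)) \<^bold>\<or> ?T"
    by (rule R5)
  then have "\<Gamma> \<turnstile>\<^sub>H ?T \<^bold>\<or> ((s \<^bold>\<or> ?T) \<^bold>\<or> ?T)"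
    by (rule r[OF disj_assoc])
  then have "\<Gamma> \<turnstile>\<^sub>H ((s \<^bold>\<or> ?T) \<^bold>\<or> ?T) \<^bold>\<or> ?T"
    by (rule R5)
  then have "\<Gamma> \<turnstile>\<^sub>H s \<^bold>\<or> (?T \<^bold>\<or> (?T \<^bold>\<or> ?T))"
    by (rule disj_assoc[OF disj_assoc])
  then have "\<Gamma> \<turnstile>\<^sub>H ?T \<^bold>\<or> (?T \<^bold>\<or> (?T \<^bold>\<or> ?T))"
    by (rule s)
  \<comment> \<open>The balanced bracketing lets \<open>R6\<close> contract twice, each time at the
    root.\<close>
  then have "\<Gamma> \<turnstile>\<^sub>H (?T \<^bold>\<or> ?T) \<^bold>\<or> (?T \<^bold>\<or> ?T)"
    by (rule R7)
  then show ?thesis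
    by (blast dest: R6)
qed

lemma conj_lift_iff: "\<Gamma> \<turnstile>\<^sub>H (p \<^bold>\<and> q) \<^bold>\<or> r \<longleftrightarrow> \<Gamma> \<turnstile>\<^sub>H p \<^bold>\<or> r \<and> \<Gamma> \<turnstile>\<^sub>H q \<^bold>\<or> r"
  by (meson R1 R2 R3 R5 R8 R9)

lemma disj_distrib_lift_iff:
  "\<Gamma> \<turnstile>\<^sub>H (p \<^bold>\<or> (q \<^bold>\<and> r)) \<^bold>\<or> s \<longleftrightarrow> \<Gamma> \<turnstile>\<^sub>H ((p \<^bold>\<or> q) \<^bold>\<and> (p \<^bold>\<or> r)) \<^bold>\<or> s"
proof -
  \<comment> \<open>Moving \<open>p\<close> into the side disjunct exposes the conjunction, and both
    sides of the claim split alike.\<close>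
  have rotate: "\<Gamma> \<turnstile>\<^sub>H (p \<^bold>\<or> x) \<^bold>\<or> s \<longleftrightarrow> \<Gamma> \<turnstile>\<^sub>H x \<^bold>\<or> (s \<^bold>\<or> p)" for x
    by (meson R5 R7 disj_assoc)
  show ?thesis
    by (simp only: rotate conj_lift_iff)
qed

text \<open>Separating \<open>\<Delta>\<close> from \<open>\<Gamma>\<close> allows a hypothesis to
  be traded for one weakened by \<open>s\<close>; this is what yields reasoning by cases.\<close>

lemma H_derives_lift:
  assumes "\<Gamma> \<turnstile>\<^sub>H \<phi>" and "\<And>\<gamma>. \<gamma> \<in> \<Gamma> \<Longrightarrow> \<Delta> \<turnstile>\<^sub>H \<gamma> \<^bold>\<or> s"
  shows "\<Delta> \<turnstile>\<^sub>H \<phi> \<^bold>\<or> s"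
  using assms(1)
proof (induction rule: H_derives.induct)
  case Hyp then show ?case by (rule assms(2))
next
  case R1 then show ?case by (simp add: conj_lift_iff)
next
  case R2 then show ?case by (simp add: conj_lift_iff)
next
  case R3 then show ?case by (simp add: conj_lift_iff)
next
  case R4 then show ?case by (blast intro: disj_weaken_lift)
next
  case R5 then show ?case by (blast intro: disj_comm_lift)
next
  case R6 then show ?case by (blast intro: disj_contract_lift)
next
  case R7 then show ?case by (blast intro: disj_assoc_lift)
next
  case R8 then show ?case by (simp only: disj_distrib_lift_iff)
next
  case R9 then show ?case by (simp only: disj_distrib_lift_iff)
\<comment> \<open>\<open>R10\<close> to \<open>R23\<close> already carry a side disjunct
  \<open>r\<close>: apply them with \<open>r \<or> s\<close> in its place and reassociate.\<close>
qed (rule H_derives.R7, blast intro: disj_assoc H_derives.intros(11-24))+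

text \<open>Lifting the first case by \<open>q\<close> turns \<open>p \<or> q\<close> into
  \<open>\<phi> \<or> q\<close>; lifting the second by \<open>\<phi>\<close> turns
  \<open>q \<or> \<phi>\<close> into \<open>\<phi> \<or> \<phi>\<close>.\<close>

lemma H_derives_disj_elim:
  assumes "\<Gamma> \<turnstile>\<^sub>H p \<^bold>\<or> q" and "insert p \<Gamma> \<turnstile>\<^sub>H \<phi>" and "insert q \<Gamma> \<turnstile>\<^sub>H \<phi>"
  shows "\<Gamma> \<turnstile>\<^sub>H \<phi>"
proof -
  have "\<Gamma> \<turnstile>\<^sub>H \<phi> \<^bold>\<or> q"
    by (rule H_derives_lift[OF assms(2)]) (use assms(1) in \<open>auto intro: Hyp R4\<close>)
  then have "\<Gamma> \<turnstile>\<^sub>H q \<^bold>\<or> \<phi>"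
    by (rule R5)
  then have "\<Gamma> \<turnstile>\<^sub>H \<phi> \<^bold>\<or> \<phi>"
    by (intro H_derives_lift[OF assms(3)]) (auto intro: Hyp R4)
  then show ?thesis
    by (rule R6)
qed

text \<open>Taking \<open>r\<close> to be \<open>q\<close> strips the side disjunct:
  \<open>p\<close> gives \<open>p \<or> q\<close>, then \<open>q \<or> q\<close>, then
  \<open>q\<close>.\<close>

lemma H_derives_from_lift:
  assumes "\<Gamma> \<turnstile>\<^sub>H p" and "\<And>r. \<Gamma> \<turnstile>\<^sub>H p \<^bold>\<or> r \<Longrightarrow> \<Gamma> \<turnstile>\<^sub>H q \<^bold>\<or> r"
  shows "\<Gamma> \<turnstile>\<^sub>H q"
  using assms by (blast intro: R4 R6)

subsection \<open>Prime theories and valuations\<close>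

text \<open>The set of all formulas qualifies, and so does the empty set, as there are no axioms;
  they induce the constant valuations \<open>Top4\<close> and \<open>Bot4\<close>.\<close>

definition prime_theory :: "'v fm set \<Rightarrow> bool" where
  "prime_theory T \<longleftrightarrow> (\<forall>p. T \<turnstile>\<^sub>H p \<longrightarrow> p \<in> T) \<and> (\<forall>p q. p \<^bold>\<or> q \<in> T \<longrightarrow> p \<in> T \<or> q \<in> T)"

lemma prime_theory_extension:
  assumes "\<not> \<Gamma> \<turnstile>\<^sub>H \<phi>"
  obtains T where "\<Gamma> \<subseteq> T" and "prime_theory T" and "\<phi> \<notin> T"
proof -
  let ?A = "{T. \<Gamma> \<subseteq> T \<and> \<not> T \<turnstile>\<^sub>H \<phi>}"
  have "\<exists>T\<in>?A. \<forall>S\<in>?A. T \<subseteq> S \<longrightarrow> S = T"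
  proof (rule subset_Zorn_nonempty)
    show "?A \<noteq> {}" using assms by blast
  next
    fix C assume C: "C \<noteq> {}" "subset.chain ?A C"
    then have "\<forall>T\<in>C. \<Gamma> \<subseteq> T \<and> \<not> T \<turnstile>\<^sub>H \<phi>"
      unfolding subset.chain_def by blast
    with C show "\<Union>C \<in> ?A"
      using H_derives_Union_chain[OF _ C(2,1)] by blast
  qed
  then obtain T where T: "\<Gamma> \<subseteq> T" "\<not> T \<turnstile>\<^sub>H \<phi>"
    and max: "\<And>S. T \<subseteq> S \<Longrightarrow> \<not> S \<turnstile>\<^sub>H \<phi> \<Longrightarrow> S = T"
    by auto
  \<comment> \<open>Maximality in this form gives closure under derivability by cut, and primeness
    by disjunction elimination.\<close>
  have insert: "insert p T \<turnstile>\<^sub>H \<phi>" if "p \<notin> T" for p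
    using max[of "insert p T"] that by blast
  have "p \<in> T" if "T \<turnstile>\<^sub>H p" for p
  proof (rule ccontr)
    assume "p \<notin> T"
    from insert[OF this] have "T \<turnstile>\<^sub>H \<phi>"
      by (rule H_derives_trans) (use that in \<open>auto intro: Hyp\<close>)
    with T(2) show False by blast
  qed
  moreover have "p \<in> T \<or> q \<in> T" if "p \<^bold>\<or> q \<in> T" for p q
    using H_derives_disj_elim[OF Hyp[OF that]] insert T(2) by blast
  ultimately have "prime_theory T"
    unfolding prime_theory_def by blast
  moreover have "\<phi> \<notin> T"
    using T(2) Hyp by blast
  ultimately show thesis
    using T(1) that by blast
qed

definition theory_val :: "'v fm set \<Rightarrow> 'v fm \<Rightarrow> four" where
  "theory_val T p =
    (if p \<in> T then if \<^bold>\<not> p \<in> T then Top4 else T4 else if \<^bold>\<not> p \<in> T then F4 else Bot4)"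

lemma theory_val_in_Tr: "theory_val T p \<in> Tr \<longleftrightarrow> p \<in> T"
  by (simp add: theory_val_def Tr_def)

text \<open>A value is fixed by two memberships, so each binary connective needs one equivalence for
  the compound and one for its negation; for negation, only double negation remains.\<close>

lemma hom_theory_val:
  assumes "prime_theory T"
  shows "hom_FOUR (theory_val T)"
proof -
  have closed: "T \<turnstile>\<^sub>H p \<longleftrightarrow> p \<in> T" for p
    using assms Hyp unfolding prime_theory_def by blast
  have interderivable: "p \<in> T \<longleftrightarrow> q \<in> T"
    if "\<And>r. T \<turnstile>\<^sub>H p \<^bold>\<or> r \<Longrightarrow> T \<turnstile>\<^sub>H q \<^bold>\<or> r" "\<And>r. T \<turnstile>\<^sub>H q \<^bold>\<or> r \<Longrightarrow> T \<turnstile>\<^sub>H p \<^bold>\<or> r" for p q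
    using that H_derives_from_lift closed by metis
  have disj: "p \<^bold>\<or> q \<in> T \<longleftrightarrow> p \<in> T \<or> q \<in> T" for p q
    using assms unfolding prime_theory_def by (blast intro: Hyp R4 R5)
  have conj: "p \<^bold>\<and> q \<in> T \<longleftrightarrow> p \<in> T \<and> q \<in> T" for p q
    using R1 R2 R3 closed by metis
  have otimes: "p \<otimes> q \<in> T \<longleftrightarrow> p \<in> T \<and> q \<in> T" for p q
    using interderivable[OF R16 R17] conj by blast
  have oplus: "p \<oplus> q \<in> T \<longleftrightarrow> p \<in> T \<or> q \<in> T" for p q
    using interderivable[OF R18 R19] disj by blast
  have neg_neg: "\<^bold>\<not> (\<^bold>\<not> p) \<in> T \<longleftrightarrow> p \<in> T" for p
    using interderivable[OF R11 R10] .
  have neg_disj: "\<^bold>\<not> (p \<^bold>\<or> q) \<in> T \<longleftrightarrow> \<^bold>\<not> p \<in> T \<and> \<^bold>\<not> q \<in> T" for p q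
    using interderivable[OF R12 R13] conj by blast
  have neg_conj: "\<^bold>\<not> (p \<^bold>\<and> q) \<in> T \<longleftrightarrow> \<^bold>\<not> p \<in> T \<or> \<^bold>\<not> q \<in> T" for p q
    using interderivable[OF R14 R15] disj by blast
  have neg_otimes: "\<^bold>\<not> (p \<otimes> q) \<in> T \<longleftrightarrow> \<^bold>\<not> p \<in> T \<and> \<^bold>\<not> q \<in> T" for p q
    using interderivable[OF R21 R20] otimes by blast
  have neg_oplus: "\<^bold>\<not> (p \<oplus> q) \<in> T \<longleftrightarrow> \<^bold>\<not> p \<in> T \<or> \<^bold>\<not> q \<in> T" for p q
    using interderivable[OF R23 R22] oplus by blast
  show ?thesis
    unfolding hom_FOUR_def theory_val_def
    by (simp add: disj conj otimes oplus neg_neg neg_disj neg_conj neg_otimes neg_oplus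
        meet_t_eq join_t_eq meet_k_eq join_k_eq le_t_def le_k_def)
qed

text \<open>The semantic counterpart of the membership equivalences for prime theories; with it the
  soundness of each rule becomes propositional reasoning about membership in
  \<open>Tr\<close>.\<close>

lemma hom_in_Tr_iff:
  assumes "hom_FOUR h"
  shows "h (p \<^bold>\<and> q) \<in> Tr \<longleftrightarrow> h p \<in> Tr \<and> h q \<in> Tr"
    and "h (p \<^bold>\<or> q) \<in> Tr \<longleftrightarrow> h p \<in> Tr \<or> h q \<in> Tr"
    and "h (p \<otimes> q) \<in> Tr \<longleftrightarrow> h p \<in> Tr \<and> h q \<in> Tr"
    and "h (p \<oplus> q) \<in> Tr \<longleftrightarrow> h p \<in> Tr \<or> h q \<in> Tr"
    and "h (\<^bold>\<not> (\<^bold>\<not> p)) \<in> Tr \<longleftrightarrow> h p \<in> Tr"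
    and "h (\<^bold>\<not> (p \<^bold>\<and> q)) \<in> Tr \<longleftrightarrow> h (\<^bold>\<not> p) \<in> Tr \<or> h (\<^bold>\<not> q) \<in> Tr"
    and "h (\<^bold>\<not> (p \<^bold>\<or> q)) \<in> Tr \<longleftrightarrow> h (\<^bold>\<not> p) \<in> Tr \<and> h (\<^bold>\<not> q) \<in> Tr"
    and "h (\<^bold>\<not> (p \<otimes> q)) \<in> Tr \<longleftrightarrow> h (\<^bold>\<not> p) \<in> Tr \<and> h (\<^bold>\<not> q) \<in> Tr"
    and "h (\<^bold>\<not> (p \<oplus> q)) \<in> Tr \<longleftrightarrow> h (\<^bold>\<not> p) \<in> Tr \<or> h (\<^bold>\<not> q) \<in> Tr"
  using assms unfolding hom_FOUR_def Tr_def
  by (cases "h p"; cases "h q";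
      simp add: meet_t_eq join_t_eq meet_k_eq join_k_eq le_t_def le_k_def)+

lemma H_derives_sound:
  assumes "\<Gamma> \<turnstile>\<^sub>H \<phi>"
  shows "\<Gamma> \<Turnstile>\<^sub>L\<^sub>B \<phi>"
  unfolding LB_entails_def
proof (intro allI impI)
  fix h :: "'a fm \<Rightarrow> four"
  assume "hom_FOUR h" and \<Gamma>: "h ` \<Gamma> \<subseteq> Tr"
  note hom_in_Tr_iff = hom_in_Tr_iff[OF \<open>hom_FOUR h\<close>]
  show "h \<phi> \<in> Tr"
    using assms
  proof (induction rule: H_derives.induct)
    case Hyp
    then show ?case using \<Gamma> by blast
  qed (auto simp: hom_in_Tr_iff)
qed

lemma H_derives_complete:
  assumes "\<Gamma> \<Turnstile>\<^sub>L\<^sub>B \<phi>"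
  shows "\<Gamma> \<turnstile>\<^sub>H \<phi>"
proof (rule ccontr)
  assume "\<not> \<Gamma> \<turnstile>\<^sub>H \<phi>"
  then obtain T where T: "\<Gamma> \<subseteq> T" "prime_theory T" "\<phi> \<notin> T"
    by (rule prime_theory_extension)
  have "theory_val T ` \<Gamma> \<subseteq> Tr"
    using T(1) by (auto simp: theory_val_in_Tr)
  then have "theory_val T \<phi> \<in> Tr"
    using assms hom_theory_val[OF T(2)] unfolding LB_entails_def by blast
  with T(3) show False
    by (simp add: theory_val_in_Tr)
qed

theorem theorem3p2p11:
  fixes \<Gamma> :: "('v::countable) fm set" and \<phi> :: "'v fm"
  shows "\<Gamma> \<Turnstile>\<^sub>L\<^sub>B \<phi> \<longleftrightarrow> \<Gamma> \<turnstile>\<^sub>H \<phi>"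
  using H_derives_sound H_derives_complete by blast

end
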